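(* Fix integers $k,k'\geq 1$ and real numbers $\delta,\delta',\epsilon>0$ with $\epsilon<1$. Suppose $f\colon X\times Y\to[0,1]$ is a function, with $X,Y$ finite nonempty sets, such that $f$ omits $(k,\delta)$-ladders and $f^{opp}$ omits $(k',\delta')$-ladders. Then there are integers $s_1\leq (9/\epsilon)^{4^{k'}}$ and $s_2\leq (9/\epsilon)^{4^{k}}$ and $f$-definable partitions $X=X_1\cup\ldots\cup X_{s_1}$ and $Y=Y_1\cup\ldots\cup Y_{s_2}$ such that for all $(i,j)\in[s_1]\times[s_2]$, the pair $(X_i,Y_j)$ is $\epsilon$-almost $2(\delta+\delta')$-constant with respect to $f$.
   Context: Conventions: $[n]=\{1,\ldots,n\}$. All sets are finite and domains of functions are nonempty. A partition of a set is a collection of pairwise disjoint nonempty subsets whose union is the set. For $f\colon X\times Y\to[0,1]$, $f^{opp}\colon Y\times X\to[0,1]$ is defined by $f^{opp}(y,x)=f(x,y)$. Ladders: given $k\geq1$ and $\delta>0$, a $(k,\delta)$-ladder for $f\colon X\times Y\to[0,1]$ consists of sequences $(x_1,\ldots,x_k)\in X^k$, $(y_1,\ldots,y_k)\in Y^k$, $(r_1,\ldots,r_k)\in[0,1]^k$ such that for all $i,j\in[k]$: if $i\leq j$ then $f(x_i,y_j)\geq r_i+\delta$, and if $i>j$ then $f(x_i,y_j)\leq r_i$. If no such sequences exist, $f$ omits $(k,\delta)$-ladders. Almost constant pairs: for $A\subseteq X$, $B\subseteq Y$ and $\delta,\epsilon>0$, the pair $(A,B)$ is $\epsilon$-almost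 $\delta$-constant with respect to $f$ if there is $E\subseteq A\times B$ with $|E|>(1-\epsilon)|A||B|$ such that $|f(x,y)-f(x',y')|<\delta$ for any $(x,y),(x',y')\in E$. Definability: a subset of $X$ is $f$-definable if it is a finite Boolean combination of sets of the form $\{x\in X: f(x,b)\geq r\}$ or $\{x\in X:f(x,b)\leq r\}$ with $b\in Y$ and $r\in[0,1]$. $f$-definable subsets of $Y$ are defined analogously, using sets $\{y\in Y:f(a,y)\geq r\}$ or $\{y\in Y:f(a,y)\leq r\}$ with $a\in X$, $r\in[0,1]$. A partition of $X$ or $Y$ is $f$-definable if all of its pieces are $f$-definable. *)

theory Defs
  imports Complex_Main "HOL-Library.Disjoint_Sets"
begin

text \<open>A function \<open>f: X \<times> Y \<rightarrow> [0,1]\<close> is a curried function \<open>'a \<Rightarrow> 'b \<Rightarrow> real\<close> together with carrier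
  sets \<open>X\<close> and \<open>Y\<close>; its values off \<open>X \<times> Y\<close> are irrelevant to every notion below.\<close>

definition opp :: "('a \<Rightarrow> 'b \<Rightarrow> real) \<Rightarrow> 'b \<Rightarrow> 'a \<Rightarrow> real" where
  "opp f = (\<lambda>y x. f x y)"

text \<open>A sequence of length \<open>k\<close> is a function on \<open>nat\<close> of which only the values on \<open>{1..k}\<close> matter.\<close>

definition is_ladder ::
  "'a set \<Rightarrow> 'b set \<Rightarrow> ('a \<Rightarrow> 'b \<Rightarrow> real) \<Rightarrow> nat \<Rightarrow> real \<Rightarrow>
    (nat \<Rightarrow> 'a) \<Rightarrow> (nat \<Rightarrow> 'b) \<Rightarrow> (nat \<Rightarrow> real) \<Rightarrow> bool" where
  "is_ladder X Y f k \<delta> x y r \<longleftrightarrow>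
    (\<forall>i\<in>{1..k}. x i \<in> X \<and> y i \<in> Y \<and> r i \<in> {0..1}) \<and>
    (\<forall>i\<in>{1..k}. \<forall>j\<in>{1..k}.
      (i \<le> j \<longrightarrow> f (x i) (y j) \<ge> r i + \<delta>) \<and>
      (i > j \<longrightarrow> f (x i) (y j) \<le> r i))"

definition omits_ladders ::
  "'a set \<Rightarrow> 'b set \<Rightarrow> ('a \<Rightarrow> 'b \<Rightarrow> real) \<Rightarrow> nat \<Rightarrow> real \<Rightarrow> bool" where
  "omits_ladders X Y f k \<delta> \<longleftrightarrow> \<not> (\<exists>x y r. is_ladder X Y f k \<delta> x y r)"

definition almost_constant ::
  "('a \<Rightarrow> 'b \<Rightarrow> real) \<Rightarrow> real \<Rightarrow> real \<Rightarrow> 'a set \<Rightarrow> 'b set \<Rightarrow> bool" where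
  "almost_constant f \<epsilon> \<delta> A B \<longleftrightarrow>
    (\<exists>E \<subseteq> A \<times> B.
      real (card E) > (1 - \<epsilon>) * real (card A) * real (card B) \<and>
      (\<forall>(x, y)\<in>E. \<forall>(x', y')\<in>E. \<bar>f x y - f x' y'\<bar> < \<delta>))"

text \<open>Finite Boolean combinations, within \<open>X\<close>, of members of \<open>G\<close>; complements are relative to \<open>X\<close>.\<close>

inductive_set boolean_combinations :: "'a set \<Rightarrow> 'a set set \<Rightarrow> 'a set set"
  for X :: "'a set" and G :: "'a set set" where
  basic: "A \<in> G \<Longrightarrow> A \<in> boolean_combinations X G"
| compl: "A \<in> boolean_combinations X G \<Longrightarrow> X - A \<in> boolean_combinations X G"
| union: "A \<in> boolean_combinations X G \<Longrightarrow> B \<in> boolean_combinations X G \<Longrightarrow>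
    A \<union> B \<in> boolean_combinations X G"
| inter: "A \<in> boolean_combinations X G \<Longrightarrow> B \<in> boolean_combinations X G \<Longrightarrow>
    A \<inter> B \<in> boolean_combinations X G"

text \<open>The definable subsets of \<open>X\<close>. Those of \<open>Y\<close> are \<open>definable_sets Y X (opp f)\<close>, whose
  generators are the sets \<open>{y \<in> Y. f a y \<ge> r}\<close> and \<open>{y \<in> Y. f a y \<le> r}\<close> with \<open>a \<in> X\<close>.\<close>

definition definable_sets :: "'a set \<Rightarrow> 'b set \<Rightarrow> ('a \<Rightarrow> 'b \<Rightarrow> real) \<Rightarrow> 'a set set" where
  "definable_sets X Y f = boolean_combinations X
    ({{x \<in> X. f x b \<ge> r} | b r. b \<in> Y \<and> r \<in> {0..1}} \<union>
     {{x \<in> X. f x b \<le> r} | b r. b \<in> Y \<and> r \<in> {0..1}})"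

end

theory Submission
  imports Defs
begin

text \<open>Call \<open>A \<subseteq> X\<close> regular if no column \<open>f(-, y)\<close> has both at least \<open>\<eta>|A|\<close> values \<open>\<le> r\<close> and at
  least \<open>\<eta>|A|\<close> values \<open>\<ge> r + 2\<delta>'\<close> on \<open>A\<close>. Splitting non-regular sets repeatedly yields a full binary
  tree with gap \<open>2\<delta>'\<close>. Such a tree of height \<open>4^k'/2 - 1\<close> contains a \<open>(k', \<delta>')\<close>-ladder for \<open>f^opp\<close>:
  the doubled gap makes room for a threshold at \<open>r + \<delta>'\<close>, by which each point of \<open>X\<close> colours the nodes,
  and \<open>2k' - 1\<close> successive passages to a monochromatic subtree give \<open>k'\<close> steps of the same colour.
  Hence every definable set contains a large definable regular subset. Removing such subsets greedily
  and adding the tiny remainder to one of them partitions \<open>X\<close>, and likewise \<open>Y\<close>; finally a pair of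
  regular sets is almost constant by a double count.\<close>

section \<open>Binary trees and chains\<close>

text \<open>These are Littlestone trees for two relations that need not be complementary. With the
  gap relations used below, the height measures sequential fat-shattering. Sibling subtrees choose
  their nodes independently.\<close>

fun shatters :: "('a \<Rightarrow> 'c \<Rightarrow> bool) \<Rightarrow> ('a \<Rightarrow> 'c \<Rightarrow> bool) \<Rightarrow> 'c set \<Rightarrow> nat \<Rightarrow> 'a set \<Rightarrow> bool" where
  "shatters L R N 0 A \<longleftrightarrow> A \<noteq> {}"
| "shatters L R N (Suc n) A \<longleftrightarrow>
    (\<exists>z\<in>N. shatters L R N n {x \<in> A. L x z} \<and> shatters L R N n {x \<in> A. R x z})"

lemma shatters_mono:
  "shatters L R N n A \<Longrightarrow> A \<subseteq> B \<Longrightarrow> shatters L R N n B"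
proof (induction n arbitrary: A B)
  case (Suc n)
  then obtain z where z: "z \<in> N" "shatters L R N n {x \<in> A. L x z}" "shatters L R N n {x \<in> A. R x z}"
    by auto
  have "{x \<in> A. L x z} \<subseteq> {x \<in> B. L x z}" "{x \<in> A. R x z} \<subseteq> {x \<in> B. R x z}"
    using Suc.prems(2) by auto
  then have "shatters L R N n {x \<in> B. L x z}" "shatters L R N n {x \<in> B. R x z}"
    using Suc.IH z(2,3) by blast+
  with z(1) show ?case by auto
qed auto

lemma shatters_nonempty: "shatters L R N n A \<Longrightarrow> A \<noteq> {}"
proof (induction n arbitrary: A)
  case (Suc n)
  then show ?case by fastforce
qed auto

text \<open>A Ramsey property of trees. If the root satisfies \<open>p\<close>, then either both
  children have a tree of height \<open>a - 1\<close> with nodes in \<open>p\<close>, and the root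
  joins these, or one child has a tree of height \<open>b\<close> with nodes outside
  \<open>p\<close>, which serves for \<open>A\<close> by monotonicity. The other colour is
  symmetric.\<close>

lemma shatters_split:
  assumes "shatters L R N h A" "a + b \<le> Suc h"
  shows "shatters L R {z \<in> N. p z} a A \<or> shatters L R {z \<in> N. \<not> p z} b A"
  using assms
proof (induction h arbitrary: a b A)
  case 0
  then have "a = 0 \<or> b = 0" by auto
  with 0 show ?case by auto
next
  case (Suc h)
  have ne: "A \<noteq> {}" using Suc.prems(1) shatters_nonempty by blast
  obtain z where z: "z \<in> N" "shatters L R N h {x \<in> A. L x z}" "shatters L R N h {x \<in> A. R x z}"
    using Suc.prems(1) by auto
  have up: "shatters L R N' n {x \<in> A. L x z} \<Longrightarrow> shatters L R N' n A"
    "shatters L R N' n {x \<in> A. R x z} \<Longrightarrow> shatters L R N' n A" for N' n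
    by (erule shatters_mono, blast)+
  consider "a = 0" | "b = 0" | a' b' where "a = Suc a'" "b = Suc b'"
    by (meson not0_implies_Suc)
  then show ?case
  proof cases
    case 3
    show ?thesis
    proof (cases "p z")
      case True
      have "a' + b \<le> Suc h" using 3 Suc.prems(2) by simp
      with Suc.IH z(2,3) have
        "shatters L R {z \<in> N. p z} a' {x \<in> A. L x z} \<or> shatters L R {z \<in> N. \<not> p z} b {x \<in> A. L x z}"
        "shatters L R {z \<in> N. p z} a' {x \<in> A. R x z} \<or> shatters L R {z \<in> N. \<not> p z} b {x \<in> A. R x z}"
        by blast+
      then show ?thesis using True z(1) up unfolding 3(1) shatters.simps(2) by blast
    next
      case False
      have "a + b' \<le> Suc h" using 3 Suc.prems(2) by simp
      with Suc.IH z(2,3) have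
        "shatters L R {z \<in> N. p z} a {x \<in> A. L x z} \<or> shatters L R {z \<in> N. \<not> p z} b' {x \<in> A. L x z}"
        "shatters L R {z \<in> N. p z} a {x \<in> A. R x z} \<or> shatters L R {z \<in> N. \<not> p z} b' {x \<in> A. R x z}"
        by blast+
      then show ?thesis using False z(1) up unfolding 3(2) shatters.simps(2) by blast
    qed
  qed (use ne in auto)
qed

text \<open>A half graph between \<open>m\<close> nodes and \<open>m + 1\<close> points. The surplus
  point lets a ladder use either the first \<open>m\<close> points or the last \<open>m\<close>,
  whichever puts the diagonal on the high side.\<close>

definition has_chain ::
  "('a \<Rightarrow> 'c \<Rightarrow> bool) \<Rightarrow> ('a \<Rightarrow> 'c \<Rightarrow> bool) \<Rightarrow> 'c set \<Rightarrow> 'a set \<Rightarrow> nat \<Rightarrow> bool" where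
  "has_chain P Q N A m \<longleftrightarrow> (\<exists>x z.
    (\<forall>j\<le>m. x j \<in> A) \<and> (\<forall>i<m. z i \<in> N) \<and>
    (\<forall>i<m. \<forall>j\<le>m. (j \<le> i \<longrightarrow> P (x j) (z i)) \<and> (i < j \<longrightarrow> Q (x j) (z i))))"

lemma has_chain_0: "A \<noteq> {} \<Longrightarrow> has_chain P Q N A 0"
  by (auto simp: has_chain_def)

lemma has_chain_mono:
  assumes "has_chain P Q N A m" "N \<subseteq> N'" "A \<subseteq> A'"
  shows "has_chain P Q N' A' m"
proof -
  obtain x z where c: "\<forall>j\<le>m. x j \<in> A" "\<forall>i<m. z i \<in> N"
    "\<forall>i<m. \<forall>j\<le>m. (j \<le> i \<longrightarrow> P (x j) (z i)) \<and> (i < j \<longrightarrow> Q (x j) (z i))"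
    using assms(1) unfolding has_chain_def by blast
  show ?thesis
    unfolding has_chain_def by (rule exI[of _ x], rule exI[of _ z]) (use c assms(2,3) in blast)
qed

text \<open>All old points are in relation \<open>Q\<close> to \<open>z0\<close>, and
  \<open>x0\<close> is in relation \<open>P\<close> to every node in \<open>N\<close>, so
  \<open>x0\<close> and \<open>z0\<close> can be put in front of the chain with all old indices
  shifted by one.\<close>

lemma has_chain_Suc:
  assumes "has_chain P Q N {x \<in> A. Q x z0} m" "x0 \<in> A" "z0 \<in> N" "\<And>z. z \<in> N \<Longrightarrow> P x0 z"
  shows "has_chain P Q N A (Suc m)"
proof -
  obtain x z where c: "\<forall>j\<le>m. x j \<in> A \<and> Q (x j) z0" "\<forall>i<m. z i \<in> N"
    "\<forall>i<m. \<forall>j\<le>m. (j \<le> i \<longrightarrow> P (x j) (z i)) \<and> (i < j \<longrightarrow> Q (x j) (z i))"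
    using assms(1) unfolding has_chain_def by auto
  show ?thesis
    unfolding has_chain_def
    by (rule exI[of _ "case_nat x0 x"], rule exI[of _ "case_nat z0 z"])
      (use c assms(2-4) in \<open>auto split: nat.splits\<close>)
qed

text \<open>A point \<open>x0\<close> colours the nodes by \<open>U x0\<close>. Passing to a monochromatic subtree and then to the
  left child of its root (colour \<open>U\<close>) or to the right child (colour \<open>\<not> U\<close>) prepends one entry to
  the chain of that colour; the chains of the other colour are untouched.\<close>

lemma shatters_has_chain:
  assumes "shatters L R N (2 ^ n - 1) A" "u + v \<le> Suc n"
  shows "has_chain U L N A u \<or> has_chain (\<lambda>x z. \<not> U x z) R N A v"
  using assms
proof (induction n arbitrary: N A u v)
  case 0
  then have A: "A \<noteq> {}" by simp
  from 0 consider "u = 0" | "v = 0" by linarith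
  then show ?case by cases (simp_all add: has_chain_0 A)
next
  case (Suc n)
  have "A \<noteq> {}" using Suc.prems(1) shatters_nonempty by blast
  then obtain x0 where x0: "x0 \<in> A" by blast
  consider "u = 0" | "v = 0" | u' v' where "u = Suc u'" "v = Suc v'"
    by (meson not0_implies_Suc)
  then show ?case
  proof cases
    case 3
    define NU ND where "NU = {z \<in> N. U x0 z}" and "ND = {z \<in> N. \<not> U x0 z}"
    have sub: "NU \<subseteq> N" "ND \<subseteq> N" by (auto simp: NU_def ND_def)
    \<comment> \<open>Either colour can be asked for height \<open>2 ^ n\<close>: one level is spent
      on the root \<open>z0\<close>, and \<open>2 ^ n - 1\<close> remains for the induction
      hypothesis.\<close>
    have h: "Suc (2 ^ n - 1) + Suc (2 ^ n - 1) \<le> Suc (2 ^ Suc n - 1 :: nat)" by simp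
    from shatters_split[OF Suc.prems(1) h, of "U x0"] show ?thesis
    proof
      assume "shatters L R {z \<in> N. U x0 z} (Suc (2 ^ n - 1)) A"
      then obtain z0 where z0: "z0 \<in> NU" "shatters L R NU (2 ^ n - 1) {x \<in> A. L x z0}"
        unfolding NU_def[symmetric] shatters.simps(2) by blast
      have "u' + v \<le> Suc n" using Suc.prems(2) 3 by simp
      from Suc.IH[OF z0(2) this] show ?thesis
      proof
        assume "has_chain U L NU {x \<in> A. L x z0} u'"
        then have "has_chain U L NU A u"
          unfolding 3(1) by (rule has_chain_Suc[OF _ x0 z0(1)]) (simp add: NU_def)
        then show ?thesis using has_chain_mono sub(1) by blast
      next
        assume "has_chain (\<lambda>x z. \<not> U x z) R NU {x \<in> A. L x z0} v"
        then have "has_chain (\<lambda>x z. \<not> U x z) R N A v"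
          by (rule has_chain_mono) (use sub in auto)
        then show ?thesis ..
      qed
    next
      assume "shatters L R {z \<in> N. \<not> U x0 z} (Suc (2 ^ n - 1)) A"
      then obtain z0 where z0: "z0 \<in> ND" "shatters L R ND (2 ^ n - 1) {x \<in> A. R x z0}"
        unfolding ND_def[symmetric] shatters.simps(2) by blast
      have "u + v' \<le> Suc n" using Suc.prems(2) 3 by simp
      from Suc.IH[OF z0(2) this] show ?thesis
      proof
        assume "has_chain (\<lambda>x z. \<not> U x z) R ND {x \<in> A. R x z0} v'"
        then have "has_chain (\<lambda>x z. \<not> U x z) R ND A v"
          unfolding 3(2) by (rule has_chain_Suc[OF _ x0 z0(1)]) (simp add: ND_def)
        then show ?thesis using has_chain_mono sub(2) by blast
      next
        assume "has_chain U L ND {x \<in> A. R x z0} u"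
        then have "has_chain U L N A u"
          by (rule has_chain_mono) (use sub in auto)
        then show ?thesis ..
      qed
    qed
  qed (simp_all add: has_chain_0 \<open>A \<noteq> {}\<close>)
qed

section \<open>Ladders\<close>

text \<open>For \<Delta> \<ge> 0 the bounds put both thresholds in the unit interval, as ladders and
  definable sets demand. They hold automatically when a function into the unit interval has points
  on both sides of the cut.\<close>

definition splitting_nodes :: "'b set \<Rightarrow> real \<Rightarrow> ('b \<times> real) set" where
  "splitting_nodes Y \<Delta> = {(y, r). y \<in> Y \<and> 0 \<le> r \<and> r + \<Delta> \<le> 1}"

abbreviation shatters_gap :: "('a \<Rightarrow> 'b \<Rightarrow> real) \<Rightarrow> 'b set \<Rightarrow> real \<Rightarrow> nat \<Rightarrow> 'a set \<Rightarrow> bool" where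
  "shatters_gap f Y \<Delta> n A \<equiv>
    shatters (\<lambda>x (y, r). f x y \<le> r) (\<lambda>x (y, r). f x y \<ge> r + \<Delta>) (splitting_nodes Y \<Delta>) n A"

text \<open>Taking \<open>u = v = k\<close> in \<open>shatters_has_chain\<close> requires
  \<open>n = 2 * k - 1\<close>. The colour is the midpoint \<open>r + \<delta>\<close> of the gap,
  so a chain of either colour still has a gap of \<delta> between its high and low values.\<close>

lemma omits_ladders_not_shatters:
  fixes f :: "'a \<Rightarrow> 'b \<Rightarrow> real"
  assumes om: "omits_ladders Y X (opp f) k \<delta>" and "k \<ge> 1" "\<delta> > 0"
  shows "\<not> shatters_gap f Y (2 * \<delta>) (2 ^ (2 * k - 1) - 1) X"
proof
  assume "shatters_gap f Y (2 * \<delta>) (2 ^ (2 * k - 1) - 1) X"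
  moreover have "k + k \<le> Suc (2 * k - 1)" by simp
  ultimately have "has_chain (\<lambda>x (y, r). f x y \<ge> r + \<delta>) (\<lambda>x (y, r). f x y \<le> r)
        (splitting_nodes Y (2 * \<delta>)) X k
      \<or> has_chain (\<lambda>x z. \<not> (\<lambda>(y, r). f x y \<ge> r + \<delta>) z) (\<lambda>x (y, r). f x y \<ge> r + 2 * \<delta>)
        (splitting_nodes Y (2 * \<delta>)) X k"
    by (rule shatters_has_chain)
  then show False
  proof
    assume "has_chain (\<lambda>x (y, r). f x y \<ge> r + \<delta>) (\<lambda>x (y, r). f x y \<le> r)
        (splitting_nodes Y (2 * \<delta>)) X k"
    then obtain x z where c: "\<And>j. j \<le> k \<Longrightarrow> x j \<in> X"
      "\<And>i. i < k \<Longrightarrow> z i \<in> splitting_nodes Y (2 * \<delta>)"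
      "\<And>i j. i < k \<Longrightarrow> j \<le> k \<Longrightarrow> j \<le> i \<Longrightarrow> f (x j) (fst (z i)) \<ge> snd (z i) + \<delta>"
      "\<And>i j. i < k \<Longrightarrow> j \<le> k \<Longrightarrow> i < j \<Longrightarrow> f (x j) (fst (z i)) \<le> snd (z i)"
      unfolding has_chain_def case_prod_beta by blast
    \<comment> \<open>Here the early points of the chain are high, whereas in a ladder the late
      columns are; both sequences are therefore reversed. The point \<open>x k\<close> is
      dropped.\<close>
    have "is_ladder Y X (opp f) k \<delta> (\<lambda>i. fst (z (k - i))) (\<lambda>j. x (k - j)) (\<lambda>i. snd (z (k - i)))"
      unfolding is_ladder_def opp_def
    proof (intro conjI ballI impI)
      fix i assume i: "i \<in> {1..k}"
      then have "z (k - i) \<in> splitting_nodes Y (2 * \<delta>)" by (intro c(2)) auto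
      then show "fst (z (k - i)) \<in> Y" "snd (z (k - i)) \<in> {0..1}"
        using \<open>\<delta> > 0\<close> by (auto simp: splitting_nodes_def)
      show "x (k - i) \<in> X" using c(1) by simp
    next
      fix i j assume "i \<in> {1..k}" "j \<in> {1..k}" "i \<le> j"
      then show "f (x (k - j)) (fst (z (k - i))) \<ge> snd (z (k - i)) + \<delta>"
        by (intro c(3)) auto
    next
      fix i j assume "i \<in> {1..k}" "j \<in> {1..k}" "i > j"
      then show "f (x (k - j)) (fst (z (k - i))) \<le> snd (z (k - i))"
        by (intro c(4)) auto
    qed
    then show False using om unfolding omits_ladders_def by blast
  next
    assume "has_chain (\<lambda>x z. \<not> (\<lambda>(y, r). f x y \<ge> r + \<delta>) z) (\<lambda>x (y, r). f x y \<ge> r + 2 * \<delta>)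
        (splitting_nodes Y (2 * \<delta>)) X k"
    then obtain x z where c: "\<And>j. j \<le> k \<Longrightarrow> x j \<in> X"
      "\<And>i. i < k \<Longrightarrow> z i \<in> splitting_nodes Y (2 * \<delta>)"
      "\<And>i j. i < k \<Longrightarrow> j \<le> k \<Longrightarrow> j \<le> i \<Longrightarrow> \<not> f (x j) (fst (z i)) \<ge> snd (z i) + \<delta>"
      "\<And>i j. i < k \<Longrightarrow> j \<le> k \<Longrightarrow> i < j \<Longrightarrow> f (x j) (fst (z i)) \<ge> snd (z i) + 2 * \<delta>"
      unfolding has_chain_def case_prod_beta by blast
    \<comment> \<open>Here the late points are already high, and the ladder's threshold is the
      midpoint. The chain is high only for \<open>i < j\<close>, so the nodes are shifted by one to
      make the diagonal high; the point \<open>x 0\<close> is dropped.\<close>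
    have "is_ladder Y X (opp f) k \<delta> (\<lambda>i. fst (z (i - 1))) x (\<lambda>i. snd (z (i - 1)) + \<delta>)"
      unfolding is_ladder_def opp_def
    proof (intro conjI ballI impI)
      fix i assume i: "i \<in> {1..k}"
      then have "z (i - 1) \<in> splitting_nodes Y (2 * \<delta>)" by (intro c(2)) auto
      then show "fst (z (i - 1)) \<in> Y" "snd (z (i - 1)) + \<delta> \<in> {0..1}"
        using \<open>\<delta> > 0\<close> by (auto simp: splitting_nodes_def)
      show "x i \<in> X" using c(1) i by simp
    next
      fix i j assume "i \<in> {1..k}" "j \<in> {1..k}" "i \<le> j"
      then have "f (x j) (fst (z (i - 1))) \<ge> snd (z (i - 1)) + 2 * \<delta>"
        by (intro c(4)) auto
      then show "f (x j) (fst (z (i - 1))) \<ge> snd (z (i - 1)) + \<delta> + \<delta>" by simp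
    next
      fix i j assume "i \<in> {1..k}" "j \<in> {1..k}" "i > j"
      then have "\<not> f (x j) (fst (z (i - 1))) \<ge> snd (z (i - 1)) + \<delta>"
        by (intro c(3)) auto
      then show "f (x j) (fst (z (i - 1))) \<le> snd (z (i - 1)) + \<delta>" by simp
    qed
    then show False using om unfolding omits_ladders_def by blast
  qed
qed

section \<open>Definable sets\<close>

lemma definable_sets_le:
  "y \<in> Y \<Longrightarrow> r \<in> {0..1} \<Longrightarrow> {x \<in> X. f x y \<le> r} \<in> definable_sets X Y f"
  unfolding definable_sets_def by (rule boolean_combinations.basic, rule UnI2, rule CollectI, rule exI[of _ y], rule exI[of _ r]) simp

lemma definable_sets_ge:
  "y \<in> Y \<Longrightarrow> r \<in> {0..1} \<Longrightarrow> {x \<in> X. f x y \<ge> r} \<in> definable_sets X Y f"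
  unfolding definable_sets_def by (rule boolean_combinations.basic, rule UnI1, rule CollectI, rule exI[of _ y], rule exI[of _ r]) simp

lemma definable_sets_Int:
  "A \<in> definable_sets X Y f \<Longrightarrow> B \<in> definable_sets X Y f \<Longrightarrow> A \<inter> B \<in> definable_sets X Y f"
  unfolding definable_sets_def by (rule boolean_combinations.inter)

lemma definable_sets_Un:
  "A \<in> definable_sets X Y f \<Longrightarrow> B \<in> definable_sets X Y f \<Longrightarrow> A \<union> B \<in> definable_sets X Y f"
  unfolding definable_sets_def by (rule boolean_combinations.union)

lemma definable_sets_Diff:
  assumes "A \<in> definable_sets X Y f" "B \<in> definable_sets X Y f" "A \<subseteq> X"
  shows "A - B \<in> definable_sets X Y f"
proof -
  have "X - B \<in> definable_sets X Y f"
    using assms(2) unfolding definable_sets_def by (rule boolean_combinations.compl)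
  then have "A \<inter> (X - B) \<in> definable_sets X Y f" using assms(1) definable_sets_Int by blast
  moreover have "A \<inter> (X - B) = A - B" using assms(3) by blast
  ultimately show ?thesis by simp
qed

lemma definable_sets_self:
  assumes "Y \<noteq> {}" "\<forall>x\<in>X. \<forall>y\<in>Y. f x y \<in> {0..1}"
  shows "X \<in> definable_sets X Y f"
proof -
  obtain y where y: "y \<in> Y" using assms(1) by blast
  have "X = {x \<in> X. f x y \<ge> 0}" using y assms(2) by auto
  with definable_sets_ge[OF y, of 0 X f] show ?thesis by simp
qed

lemma definable_sets_restrict_le:
  assumes "A \<in> definable_sets X Y f" "A \<subseteq> X" "y \<in> Y" "r \<in> {0..1}"
  shows "{x \<in> A. f x y \<le> r} \<in> definable_sets X Y f"
proof -
  have "{x \<in> A. f x y \<le> r} = A \<inter> {x \<in> X. f x y \<le> r}" using assms(2) by blast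
  then show ?thesis using assms by (simp add: definable_sets_Int definable_sets_le)
qed

lemma definable_sets_restrict_ge:
  assumes "A \<in> definable_sets X Y f" "A \<subseteq> X" "y \<in> Y" "r \<in> {0..1}"
  shows "{x \<in> A. f x y \<ge> r} \<in> definable_sets X Y f"
proof -
  have "{x \<in> A. f x y \<ge> r} = A \<inter> {x \<in> X. f x y \<ge> r}" using assms(2) by blast
  then show ?thesis using assms by (simp add: definable_sets_Int definable_sets_ge)
qed

section \<open>Regular sets\<close>

definition regular_set :: "('a \<Rightarrow> 'b \<Rightarrow> real) \<Rightarrow> 'b set \<Rightarrow> real \<Rightarrow> real \<Rightarrow> 'a set \<Rightarrow> bool" where
  "regular_set f Y \<eta> \<Delta> A \<longleftrightarrow> (\<forall>y\<in>Y. \<forall>r.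
    real (card {x \<in> A. f x y \<le> r}) < \<eta> * real (card A) \<or>
    real (card {x \<in> A. f x y \<ge> r + \<Delta>}) < \<eta> * real (card A))"

text \<open>A column violating regularity cuts off two parts, each of size at least \<eta> times
  that of \<open>A\<close>. They cannot both be shattered to the next lower height, so one can
  descend into a part that is not, losing one factor \<eta> and one level. At \<open>n = 0\<close>
  nothing is lost: two nonempty parts would already form a tree of height 1.\<close>

lemma exists_regular_subset:
  assumes "finite X" "\<forall>x\<in>X. \<forall>y\<in>Y. f x y \<in> {0..1}" "\<Delta> > 0" "0 < \<eta>" "\<eta> \<le> 1"
    and "A \<in> definable_sets X Y f" "A \<subseteq> X" "A \<noteq> {}"
    and "\<not> shatters_gap f Y \<Delta> (Suc n) A"
  shows "\<exists>B\<subseteq>A. B \<in> definable_sets X Y f \<and> regular_set f Y \<eta> \<Delta> B \<and>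
    \<eta> ^ n * real (card A) \<le> real (card B)"
  using assms(6-9)
proof (induction n arbitrary: A)
  case (0 A)
  note A = this
  show ?case
  proof (rule ccontr)
    assume "\<not> ?thesis"
    with A(1) have "\<not> regular_set f Y \<eta> \<Delta> A" by auto
    then obtain y r where yr: "y \<in> Y" "\<eta> * real (card A) \<le> real (card {x \<in> A. f x y \<le> r})"
      "\<eta> * real (card A) \<le> real (card {x \<in> A. f x y \<ge> r + \<Delta>})"
      unfolding regular_set_def by (meson not_less)
    have "0 < \<eta> * real (card A)"
      using A \<open>0 < \<eta>\<close> \<open>finite X\<close> by (simp add: card_gt_0_iff finite_subset)
    with yr have ne: "{x \<in> A. f x y \<le> r} \<noteq> {}" "{x \<in> A. f x y \<ge> r + \<Delta>} \<noteq> {}"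
      by (metis card.empty not_less of_nat_0)+
    then have "0 \<le> r" "r + \<Delta> \<le> 1"
      using assms(2) A(2) yr(1) by fastforce+
    with yr(1) have "(y, r) \<in> splitting_nodes Y \<Delta>" by (simp add: splitting_nodes_def)
    with ne A(4) show False by auto
  qed
next
  case (Suc n A)
  note A = Suc.prems
  show ?case
  proof (cases "regular_set f Y \<eta> \<Delta> A")
    case True
    have "\<eta> ^ Suc n * real (card A) \<le> real (card A)"
      using assms(4,5) by (intro mult_left_le_one_le power_le_one) auto
    with True A(1) show ?thesis by blast
  next
    case False
    then obtain y r where yr: "y \<in> Y" "\<eta> * real (card A) \<le> real (card {x \<in> A. f x y \<le> r})"
      "\<eta> * real (card A) \<le> real (card {x \<in> A. f x y \<ge> r + \<Delta>})"
      unfolding regular_set_def by (meson not_less)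
    have "0 < \<eta> * real (card A)"
      using A \<open>0 < \<eta>\<close> \<open>finite X\<close> by (simp add: card_gt_0_iff finite_subset)
    with yr have ne: "{x \<in> A. f x y \<le> r} \<noteq> {}" "{x \<in> A. f x y \<ge> r + \<Delta>} \<noteq> {}"
      by (metis card.empty not_less of_nat_0)+
    then have r: "0 \<le> r" "r + \<Delta> \<le> 1"
      using assms(2) A(2) yr(1) by fastforce+
    with yr(1) have node: "(y, r) \<in> splitting_nodes Y \<Delta>" by (simp add: splitting_nodes_def)
    have r': "r \<in> {0..1}" "r + \<Delta> \<in> {0..1}" using r \<open>\<Delta> > 0\<close> by auto
    have "\<exists>C\<subseteq>A. C \<in> definable_sets X Y f \<and> C \<noteq> {} \<and> \<eta> * real (card A) \<le> real (card C) \<and>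
        \<not> shatters_gap f Y \<Delta> (Suc n) C"
    proof (cases "shatters_gap f Y \<Delta> (Suc n) {x \<in> A. f x y \<le> r}")
      case False
      then show ?thesis
        using ne yr definable_sets_restrict_le[OF A(1,2) yr(1) r'(1)]
        by (intro exI[of _ "{x \<in> A. f x y \<le> r}"]) blast
    next
      case True
      then have "\<not> shatters_gap f Y \<Delta> (Suc n) {x \<in> A. f x y \<ge> r + \<Delta>}"
        using A(4) node by (subst (asm) shatters.simps(2)[of _ _ _ "Suc n"]) auto
      then show ?thesis
        using ne yr definable_sets_restrict_ge[OF A(1,2) yr(1) r'(2)]
        by (intro exI[of _ "{x \<in> A. f x y \<ge> r + \<Delta>}"]) blast
    qed
    then obtain C where C: "C \<subseteq> A" "C \<in> definable_sets X Y f" "C \<noteq> {}"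
      "\<eta> * real (card A) \<le> real (card C)" "\<not> shatters_gap f Y \<Delta> (Suc n) C" by blast
    obtain B where B: "B \<subseteq> C" "B \<in> definable_sets X Y f" "regular_set f Y \<eta> \<Delta> B"
      "\<eta> ^ n * real (card C) \<le> real (card B)"
      using Suc.IH[OF C(2) _ C(3) C(5)] C(1) A(2) by blast
    have "\<eta> ^ Suc n * real (card A) = \<eta> ^ n * (\<eta> * real (card A))" by simp
    also have "\<dots> \<le> \<eta> ^ n * real (card C)" using C(4) assms(4) by (intro mult_left_mono) auto
    finally show ?thesis using B C(1) by (meson order_trans)
  qed
qed

section \<open>Greedy exhaustion by large regular pieces\<close>

text \<open>A good subset is removed as long as at least \<tau> points remain, hence the lower bound
  \<open>c * \<tau>\<close> for each piece. Positivity of this bound makes the process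
  terminate.\<close>

lemma regular_pieces:
  assumes "finite X" "\<tau> > 0" "\<And>A. A \<in> D \<Longrightarrow> A \<subseteq> X"
    and sel: "\<And>A. A \<in> D \<Longrightarrow> A \<noteq> {} \<Longrightarrow> \<exists>B\<subseteq>A. B \<in> D \<and> good B \<and> c * real (card A) \<le> real (card B)"
    and diff: "\<And>A B. A \<in> D \<Longrightarrow> B \<in> D \<Longrightarrow> A - B \<in> D"
    and "c > 0" "R \<in> D"
  shows "\<exists>P. P \<subseteq> D \<and> disjoint P \<and> \<Union>P \<subseteq> R \<and> R - \<Union>P \<in> D \<and> real (card (R - \<Union>P)) < \<tau> \<and>
    (\<forall>B\<in>P. good B \<and> c * \<tau> \<le> real (card B))"
  using \<open>R \<in> D\<close>
proof (induction "card R" arbitrary: R rule: less_induct)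
  case less
  show ?case
  proof (cases "real (card R) < \<tau>")
    case True
    with less.prems show ?thesis by (intro exI[of _ "{}"]) auto
  next
    case False
    then have "R \<noteq> {}" using \<open>\<tau> > 0\<close> by auto
    then obtain B where B: "B \<subseteq> R" "B \<in> D" "good B" "c * real (card R) \<le> real (card B)"
      using sel less.prems by blast
    have fin: "finite R" using less.prems assms(1,3) finite_subset by blast
    have big: "c * \<tau> \<le> real (card B)"
      using False B(4) \<open>c > 0\<close> by (smt (verit) mult_left_mono)
    have "0 < c * \<tau>" using \<open>c > 0\<close> \<open>\<tau> > 0\<close> by simp
    then have "B \<noteq> {}" using big by auto
    then have "card (R - B) < card R" using B(1) fin by (intro psubset_card_mono) auto
    from less.hyps[OF this diff[OF less.prems B(2)]] obtain P where P: "P \<subseteq> D" "disjoint P"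
      "\<Union>P \<subseteq> R - B" "R - B - \<Union>P \<in> D" "real (card (R - B - \<Union>P)) < \<tau>"
      "\<forall>B\<in>P. good B \<and> c * \<tau> \<le> real (card B)" by blast
    have eq: "R - \<Union>(insert B P) = R - B - \<Union>P" by auto
    show ?thesis
    proof (rule exI[of _ "insert B P"], intro conjI)
      show "disjoint (insert B P)" using P(2,3) by (auto simp: disjoint_def)
      show "insert B P \<subseteq> D" using P(1) B(2) by simp
      show "\<Union>(insert B P) \<subseteq> R" using P(3) B(1) by auto
      show "R - \<Union>(insert B P) \<in> D" unfolding eq by (rule P(4))
      show "real (card (R - \<Union>(insert B P))) < \<tau>" unfolding eq by (rule P(5))
      show "\<forall>C\<in>insert B P. good C \<and> c * \<tau> \<le> real (card C)" using P(6) B(3) big by simp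
    qed
  qed
qed

lemma card_disjoint_le:
  assumes "finite X" "disjoint P" "\<Union>P \<subseteq> X" "\<And>B. B \<in> P \<Longrightarrow> c \<le> real (card B)"
  shows "real (card P) * c \<le> real (card X)"
proof -
  have fin: "finite B" if "B \<in> P" for B
    by (rule finite_subset[OF _ assms(1)]) (use that assms(3) in auto)
  have "real (card P) * c = (\<Sum>B\<in>P. c)" by simp
  also have "\<dots> \<le> (\<Sum>B\<in>P. real (card B))" using assms(4) by (rule sum_mono)
  also have "\<dots> = real (card (\<Union>P))"
    using card_Union_disjoint[of P] assms(2) fin by (simp add: disjoint_def pairwise_def disjnt_def)
  also have "\<dots> \<le> real (card X)" using assms(1,3) by (simp add: card_mono)
  finally show ?thesis .
qed

text \<open>Adding \<open>R\<close> raises each count by at most \<eta>/2 times the size of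
  \<open>A\<close>, while the reference size does not shrink; this accounts for the factor
  3/2.\<close>

lemma regular_set_Un:
  assumes "regular_set f Y \<eta> \<Delta> A" "finite A" "finite R"
    and "real (card R) \<le> \<eta> / 2 * real (card A)" "0 < \<eta>"
  shows "regular_set f Y (3 / 2 * \<eta>) \<Delta> (A \<union> R)"
proof -
  have split: "real (card {x \<in> A \<union> R. p x}) \<le> real (card {x \<in> A. p x}) + \<eta> / 2 * real (card A)" for p
  proof -
    have "card {x \<in> A \<union> R. p x} \<le> card ({x \<in> A. p x} \<union> R)"
      using assms(2,3) by (intro card_mono) auto
    also have "\<dots> \<le> card {x \<in> A. p x} + card R" by (rule card_Un_le)
    finally show ?thesis using assms(4) by linarith
  qed
  have "card A \<le> card (A \<union> R)" using assms(2,3) by (intro card_mono) auto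
  then have "\<eta> * real (card A) + \<eta> / 2 * real (card A) \<le> 3 / 2 * \<eta> * real (card (A \<union> R))"
    using \<open>0 < \<eta>\<close> by (simp add: field_simps)
  then have lt: "real (card {x \<in> A \<union> R. p x}) < 3 / 2 * \<eta> * real (card (A \<union> R))"
    if "real (card {x \<in> A. p x}) < \<eta> * real (card A)" for p
    using split[of p] that by linarith
  show ?thesis
    unfolding regular_set_def
  proof (intro ballI allI)
    fix y r assume "y \<in> Y"
    then have "real (card {x \<in> A. f x y \<le> r}) < \<eta> * real (card A) \<or>
        real (card {x \<in> A. f x y \<ge> r + \<Delta>}) < \<eta> * real (card A)"
      using assms(1) unfolding regular_set_def by blast
    then show "real (card {x \<in> A \<union> R. f x y \<le> r}) < 3 / 2 * \<eta> * real (card (A \<union> R)) \<or>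
        real (card {x \<in> A \<union> R. f x y \<ge> r + \<Delta>}) < 3 / 2 * \<eta> * real (card (A \<union> R))"
      using lt[of "\<lambda>x. f x y \<le> r"] lt[of "\<lambda>x. f x y \<ge> r + \<Delta>"] by blast
  qed
qed

lemma regular_partition:
  assumes "finite X" "X \<noteq> {}" "Y \<noteq> {}" "\<forall>x\<in>X. \<forall>y\<in>Y. f x y \<in> {0..1}"
    and "omits_ladders Y X (opp f) k \<delta>" "k \<ge> 1" "\<delta> > 0" "0 < \<eta>" "\<eta> \<le> 1 / 2"
  shows "\<exists>P. partition_on X P \<and> P \<subseteq> definable_sets X Y f \<and> real (card P) \<le> (1 / \<eta>) ^ (4 ^ k) \<and>
    (\<forall>A\<in>P. regular_set f Y (3 / 2 * \<eta>) (2 * \<delta>) A)"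
proof -
  define D where "D = {A \<in> definable_sets X Y f. A \<subseteq> X}"
  \<comment> \<open>\<open>Suc d\<close> is the tree height excluded by the omitted ladders, so
    large regular subsets cost a factor \<open>\<eta> ^ d\<close>. Moreover \<open>2 * d + 2\<close>
    equals \<open>4 ^ k - 2\<close>.\<close>
  define d :: nat where "d = 2 ^ (2 * k - 1) - 2"
  have "2 ^ 1 \<le> (2::nat) ^ (2 * k - 1)" using \<open>k \<ge> 1\<close> by (intro power_increasing) auto
  then have d2: "d + 2 = 2 ^ (2 * k - 1)" unfolding d_def by simp
  then have Sd: "Suc d = 2 ^ (2 * k - 1) - 1" by linarith
  have "(2::nat) * 2 ^ (2 * k - 1) = 2 ^ (2 * k)" using \<open>k \<ge> 1\<close> by (cases k) auto
  also have "\<dots> = 4 ^ k" by (simp add: power_mult)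
  finally have d4: "2 * d + 2 \<le> 4 ^ k" using d2 by linarith
  have ns: "\<not> shatters_gap f Y (2 * \<delta>) (Suc d) A" if "A \<subseteq> X" for A
    using omits_ladders_not_shatters[OF assms(5-7)] that shatters_mono unfolding Sd by blast
  have sel: "\<exists>B\<subseteq>A. B \<in> D \<and> regular_set f Y \<eta> (2 * \<delta>) B \<and> \<eta> ^ d * real (card A) \<le> real (card B)"
    if "A \<in> D" "A \<noteq> {}" for A
    using exists_regular_subset[of X Y f "2 * \<delta>" \<eta> A d] that ns[of A] assms
    unfolding D_def by auto
  have diff: "A - B \<in> D" if "A \<in> D" "B \<in> D" for A B
    using that definable_sets_Diff unfolding D_def by blast
  have XD: "X \<in> D" using definable_sets_self[OF assms(3,4)] unfolding D_def by simp
  \<comment> \<open>\<open>B1\<close> is set aside before the exhaustion starts, so that a piece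
    large relative to all of \<open>X\<close> can absorb the remainder.\<close>
  obtain B1 where B1: "B1 \<subseteq> X" "B1 \<in> D" "regular_set f Y \<eta> (2 * \<delta>) B1"
    "\<eta> ^ d * real (card X) \<le> real (card B1)"
    using sel[OF XD \<open>X \<noteq> {}\<close>] by blast
  \<comment> \<open>The two extra factors \<eta> make the remainder smaller than
    \<open>\<eta> ^ 2\<close> times the size of \<open>B1\<close>. Since \<eta> \<le> 1/2, this is
    at most the \<eta>/2 allowed by \<open>regular_set_Un\<close>.\<close>
  define \<tau> where "\<tau> = \<eta> ^ (d + 2) * real (card X)"
  have cX: "real (card X) > 0" using assms(1,2) by (simp add: card_gt_0_iff)
  have "\<tau> > 0" unfolding \<tau>_def using cX \<open>0 < \<eta>\<close> by simp
  obtain P where P: "P \<subseteq> D" "disjoint P" "\<Union>P \<subseteq> X - B1" "X - B1 - \<Union>P \<in> D"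
    "real (card (X - B1 - \<Union>P)) < \<tau>"
    "\<And>B. B \<in> P \<Longrightarrow> regular_set f Y \<eta> (2 * \<delta>) B" "\<And>B. B \<in> P \<Longrightarrow> \<eta> ^ d * \<tau> \<le> real (card B)"
    using regular_pieces[of X \<tau> D "regular_set f Y \<eta> (2 * \<delta>)" "\<eta> ^ d" "X - B1",
        OF \<open>finite X\<close> \<open>\<tau> > 0\<close> _ sel diff _ diff[OF XD B1(2)]] \<open>0 < \<eta>\<close>
    unfolding D_def by auto
  define R where "R = X - B1 - \<Union>P"
  define B0 where "B0 = B1 \<union> R"
  have fin: "finite A" if "A \<subseteq> X" for A using that assms(1) finite_subset by blast
  have le1: "\<eta> ^ d * \<tau> \<le> \<eta> ^ d * real (card X)"
    unfolding \<tau>_def using \<open>0 < \<eta>\<close> \<open>\<eta> \<le> 1 / 2\<close>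
    by (intro mult_left_mono mult_left_le_one_le power_le_one) auto
  have pos: "0 < \<eta> ^ d * \<tau>" using \<open>0 < \<eta>\<close> \<open>\<tau> > 0\<close> by simp
  have "card B1 \<le> card B0"
    unfolding B0_def R_def using assms(1) B1(1) by (intro card_mono) (auto intro: fin)
  then have B0big: "\<eta> ^ d * \<tau> \<le> real (card B0)" using B1(4) le1 by linarith
  have "\<tau> = \<eta> ^ 2 * (\<eta> ^ d * real (card X))" unfolding \<tau>_def by (simp add: power_add power2_eq_square)
  also have "\<dots> \<le> \<eta> ^ 2 * real (card B1)" using B1(4) by (intro mult_left_mono) auto
  also have "\<dots> \<le> \<eta> / 2 * real (card B1)"
    using \<open>0 < \<eta>\<close> \<open>\<eta> \<le> 1 / 2\<close> by (intro mult_right_mono) (auto simp: power2_eq_square)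
  finally have "real (card R) \<le> \<eta> / 2 * real (card B1)" using P(5) unfolding R_def by linarith
  then have B0reg: "regular_set f Y (3 / 2 * \<eta>) (2 * \<delta>) B0"
    unfolding B0_def using B1 \<open>0 < \<eta>\<close> R_def by (intro regular_set_Un) (auto intro: fin)
  have Preg: "regular_set f Y (3 / 2 * \<eta>) (2 * \<delta>) B" if "B \<in> P" for B
  proof -
    have "finite B" using that P(3) by (intro fin) auto
    then have "regular_set f Y (3 / 2 * \<eta>) (2 * \<delta>) (B \<union> {})"
      using P(6)[OF that] \<open>0 < \<eta>\<close> by (intro regular_set_Un) auto
    then show ?thesis by simp
  qed
  have dis: "disjoint (insert B0 P)"
    using P(2,3) unfolding B0_def R_def by (auto simp: disjoint_def)
  have un: "\<Union>(insert B0 P) = X" using P(3) B1(1) unfolding B0_def R_def by auto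
  have big: "\<eta> ^ d * \<tau> \<le> real (card B)" if "B \<in> insert B0 P" for B
    using that B0big P(7) by auto
  have "{} \<notin> insert B0 P" using big[of "{}"] pos by auto
  with dis un have part: "partition_on X (insert B0 P)" unfolding partition_on_def by simp
  have def: "insert B0 P \<subseteq> definable_sets X Y f"
    using P(1,4) B1(2) unfolding B0_def R_def D_def by (auto intro: definable_sets_Un)
  \<comment> \<open>Every piece contains at least a fraction \<open>q\<close> of \<open>X\<close>,
    one factor \<open>\<eta> ^ d\<close> coming from the selection and
    \<open>\<eta> ^ (d + 2)\<close> from \<tau>; hence there are at most \<open>1 / q\<close>
    pieces.\<close>
  define q where "q = \<eta> ^ (2 * d + 2)"
  have q: "q = \<eta> ^ d * \<eta> ^ (d + 2)"
    unfolding q_def by (simp only: mult_2 power_add[symmetric] add.assoc)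
  have "q > 0" unfolding q_def using \<open>0 < \<eta>\<close> by (rule zero_less_power)
  have "real (card (insert B0 P)) * (\<eta> ^ d * \<tau>) \<le> real (card X)"
    by (rule card_disjoint_le[OF assms(1) dis _ big]) (use un in auto)
  moreover have "\<eta> ^ d * \<tau> = q * real (card X)" unfolding \<tau>_def q by (rule mult.assoc[symmetric])
  ultimately have "(real (card (insert B0 P)) * q) * real (card X) \<le> 1 * real (card X)"
    by (simp only: mult.assoc mult_1)
  then have "real (card (insert B0 P)) * q \<le> 1" using cX by (rule mult_right_le_imp_le)
  then have "real (card (insert B0 P)) \<le> 1 / q" using pos_le_divide_eq[OF \<open>q > 0\<close>] by blast
  also have "\<dots> = (1 / \<eta>) ^ (2 * d + 2)" unfolding q_def by (rule power_one_over[symmetric])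
  also have "\<dots> \<le> (1 / \<eta>) ^ (4 ^ k)"
    using \<open>0 < \<eta>\<close> \<open>\<eta> \<le> 1 / 2\<close> d4 by (intro power_increasing) auto
  finally have "real (card (insert B0 P)) \<le> (1 / \<eta>) ^ (4 ^ k)" .
  moreover have "\<forall>A\<in>insert B0 P. regular_set f Y (3 / 2 * \<eta>) (2 * \<delta>) A" using B0reg Preg by simp
  ultimately show ?thesis using part def by (intro exI[of _ "insert B0 P"]) simp
qed

section \<open>Pairs of regular sets\<close>

text \<open>The witness is the least attained value whose lower level set has more than
  \<open>c\<close> points. Points strictly below it lie in the level set of the next smaller value,
  which has at most \<open>c\<close>.\<close>

lemma quantile:
  fixes g :: "'c \<Rightarrow> real" and c :: real
  assumes "finite S" "0 \<le> c" "c < real (card S)"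
  shows "\<exists>t. real (card {p \<in> S. g p < t}) \<le> c \<and> c < real (card {p \<in> S. g p \<le> t})"
proof -
  define V where "V = {v \<in> g ` S. c < real (card {p \<in> S. g p \<le> v})}"
  have finV: "finite V" unfolding V_def using assms(1) by simp
  have ne: "S \<noteq> {}" using assms(2,3) by auto
  have "{p \<in> S. g p \<le> Max (g ` S)} = S" using assms(1) by auto
  then have "Max (g ` S) \<in> V" unfolding V_def using assms ne by simp
  then have neV: "V \<noteq> {}" by blast
  have "Min V \<in> V" using finV neV by simp
  then have 1: "c < real (card {p \<in> S. g p \<le> Min V})" unfolding V_def by simp
  have 2: "real (card {p \<in> S. g p < Min V}) \<le> c"
  proof (cases "{p \<in> S. g p < Min V} = {}")
    case True
    show ?thesis unfolding True using assms(2) by simp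
  next
    case False
    define W where "W = g ` {p \<in> S. g p < Min V}"
    have W: "finite W" "W \<noteq> {}" unfolding W_def using False assms(1) by auto
    then have M: "Max W \<in> W" by simp
    then have "Max W < Min V" "Max W \<in> g ` S" unfolding W_def by auto
    then have "Max W \<notin> V" using finV by (meson Min_le not_less)
    with \<open>Max W \<in> g ` S\<close> have "real (card {p \<in> S. g p \<le> Max W}) \<le> c" unfolding V_def by simp
    moreover have "{p \<in> S. g p < Min V} \<subseteq> {p \<in> S. g p \<le> Max W}"
      using W(1) unfolding W_def by auto
    then have "card {p \<in> S. g p < Min V} \<le> card {p \<in> S. g p \<le> Max W}"
      using assms(1) by (intro card_mono) auto
    ultimately show ?thesis by linarith
  qed
  from 1 2 show ?thesis by blast
qed

text \<open>The whole set counted lies below its own highest point, whose lower level set has fewer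
  than \<open>c\<close> elements by choice.\<close>

lemma card_bottom_less:
  fixes g :: "'c \<Rightarrow> real" and c :: real
  assumes "finite S" "0 < c"
  shows "real (card {y \<in> S. real (card {y' \<in> S. g y' \<le> g y}) < c}) < c"
proof (cases "{y \<in> S. real (card {y' \<in> S. g y' \<le> g y}) < c} = {}")
  case True
  show ?thesis unfolding True using assms(2) by simp
next
  case False
  define T where "T = {y \<in> S. real (card {y' \<in> S. g y' \<le> g y}) < c}"
  have T: "finite T" "T \<noteq> {}" unfolding T_def using False assms(1) by auto
  then have "Max (g ` T) \<in> g ` T" by simp
  then obtain z where z: "z \<in> T" "g z = Max (g ` T)" by auto
  then have "T \<subseteq> {y' \<in> S. g y' \<le> g z}" using T unfolding T_def by auto
  then have "card T \<le> card {y' \<in> S. g y' \<le> g z}" using assms(1) by (intro card_mono) auto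
  moreover have "real (card {y' \<in> S. g y' \<le> g z}) < c" using z(1) unfolding T_def by simp
  ultimately show ?thesis unfolding T_def[symmetric] by linarith
qed

lemma card_Sigma_less:
  fixes c :: real
  assumes "finite A" "A \<noteq> {}" "\<And>x. x \<in> A \<Longrightarrow> finite (T x)" "\<And>x. x \<in> A \<Longrightarrow> real (card (T x)) < c"
  shows "real (card (Sigma A T)) < real (card A) * c"
proof -
  have "real (card (Sigma A T)) = (\<Sum>x\<in>A. real (card (T x)))"
    using assms(1,3) by (simp add: card_SigmaI)
  also have "\<dots> < (\<Sum>x\<in>A. c)" using assms by (intro sum_strict_mono) auto
  finally show ?thesis by simp
qed

lemma regular_opp_row:
  assumes "regular_set (opp f) A \<eta> \<Delta> B" "x \<in> A" "\<eta> * real (card B) \<le> real (card {y' \<in> B. f x y' \<le> r})"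
  shows "real (card {y' \<in> B. f x y' \<ge> r + \<Delta>}) < \<eta> * real (card B)"
  using assms unfolding regular_set_def opp_def by (meson not_less)

text \<open>Let \<open>t\<close> be a low quantile of \<open>f\<close> on \<open>A \<times> B\<close>. If \<open>(x, y)\<close> has value at most \<open>t\<close> and
  \<open>(x', y')\<close> has value at least \<open>t + a + b\<close>, then at the corner \<open>(x, y')\<close> either the row of \<open>x\<close>
  jumps by \<open>b\<close> or the column of \<open>y'\<close> jumps by \<open>a\<close>. Regularity makes both rare, unless \<open>(x, y)\<close> is
  among the lowest in its row or \<open>(x', y')\<close> among the highest in its column; so the rows of low
  points and the columns of high points cannot both be numerous.\<close>

lemma regular_pair_almost_constant:
  assumes fin: "finite A" "finite B" and ne: "A \<noteq> {}" "B \<noteq> {}"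
    and regA: "regular_set f B \<eta> a A" and regB: "regular_set (opp f) A \<eta> b B"
    and "0 < \<eta>" "\<eta> \<le> 1 / 3" "6 * \<eta> \<le> \<epsilon>"
  shows "almost_constant f \<epsilon> (a + b) A B"
proof -
  define m n where "m = real (card A)" and "n = real (card B)"
  have m: "m > 0" and n: "n > 0" unfolding m_def n_def using fin ne by (simp_all add: card_gt_0_iff)
  define bot where "bot = Sigma A (\<lambda>x. {y \<in> B. real (card {y' \<in> B. f x y' \<le> f x y}) < \<eta> * n})"
  \<comment> \<open>Negating \<open>f\<close> turns the highest points of a column into lowest ones,
    so \<open>card_bottom_less\<close> covers both cases; \<open>top\<close> restores the order of
    coordinates.\<close>
  define top' where "top' = Sigma B (\<lambda>y. {x \<in> A. real (card {x' \<in> A. - f x' y \<le> - f x y}) < \<eta> * m})"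
  define top where "top = (\<lambda>(y, x). (x, y)) ` top'"
  have botc: "real (card bot) < m * (\<eta> * n)"
    unfolding bot_def m_def using fin ne \<open>0 < \<eta>\<close> n
    by (intro card_Sigma_less card_bottom_less) auto
  have "real (card top') < n * (\<eta> * m)"
    unfolding top'_def n_def using fin ne \<open>0 < \<eta>\<close> m
    by (intro card_Sigma_less card_bottom_less) auto
  moreover have "card top \<le> card top'"
    unfolding top_def top'_def using fin by (intro card_image_le) auto
  ultimately have topc: "real (card top) < n * (\<eta> * m)" by linarith
  have bots: "bot \<subseteq> A \<times> B" and tops: "top \<subseteq> A \<times> B" unfolding bot_def top_def top'_def by auto
  have finAB: "finite (A \<times> B)" using fin by simp
  define g where "g = (\<lambda>p. f (fst p) (snd p))"
  define N where "N = A \<times> B - bot"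
  have finN: "finite N" unfolding N_def using finAB by simp
  have cAB: "real (card (A \<times> B)) = m * n" unfolding m_def n_def by (simp add: card_cartesian_product)
  have "card N = card (A \<times> B) - card bot"
    unfolding N_def using bots finAB by (intro card_Diff_subset) (auto intro: finite_subset)
  then have "real (card N) \<ge> m * n - real (card bot)" using cAB by linarith
  \<comment> \<open>\<open>N\<close> has more than \<open>(1 - \<eta>) * m * n\<close> points, and
    \<eta> \<le> 1/3 makes this at least the quantile level
    \<open>2 * \<eta> * m * n\<close>.\<close>
  moreover have "3 * \<eta> * (m * n) \<le> 1 * (m * n)"
    using \<open>\<eta> \<le> 1 / 3\<close> m n by (intro mult_right_mono) auto
  ultimately have "2 * \<eta> * m * n < real (card N)" using botc by (simp add: algebra_simps)
  moreover have "0 \<le> 2 * \<eta> * m * n" using \<open>0 < \<eta>\<close> m n by simp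
  ultimately obtain t where t: "real (card {p \<in> N. g p < t}) \<le> 2 * \<eta> * m * n"
    "2 * \<eta> * m * n < real (card {p \<in> N. g p \<le> t})"
    using quantile[OF finN, of "2 * \<eta> * m * n" g] by blast
  define H where "H = {p \<in> A \<times> B - top. g p \<ge> t + a + b}"
  define P Q where "P = fst ` {p \<in> N. g p \<le> t}" and "Q = snd ` H"
  have PA: "P \<subseteq> A" and QB: "Q \<subseteq> B" unfolding P_def Q_def N_def H_def by auto
  have finP: "finite P" and finQ: "finite Q" using PA QB fin finite_subset by auto
  have "card {p \<in> N. g p \<le> t} \<le> card (P \<times> B)"
    unfolding P_def N_def using fin by (intro card_mono) (force intro!: finite_cartesian_product)+
  then have "real (card {p \<in> N. g p \<le> t}) \<le> real (card P) * n"
    by (simp add: n_def card_cartesian_product flip: of_nat_mult)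
  then have "2 * \<eta> * m * n < real (card P) * n" using t(2) by linarith
  then have Pbig: "2 * \<eta> * m < real (card P)" using n by simp
  \<comment> \<open>A row in \<open>P\<close> contains a pair outside \<open>bot\<close> with value
    at most \<open>t\<close>, so at least \<open>\<eta> * n\<close> entries lie at or below that
    value. Regularity of \<open>B\<close> then bounds the entries higher by
    \<open>b\<close>.\<close>
  have row: "real (card {y' \<in> Q. f x y' \<ge> t + b}) \<le> \<eta> * n" if "x \<in> P" for x
  proof -
    from that obtain y where y: "(x, y) \<in> N" "f x y \<le> t" unfolding P_def g_def by auto
    then have "x \<in> A" "\<eta> * n \<le> real (card {y' \<in> B. f x y' \<le> f x y})"
      unfolding N_def bot_def by auto
    then have "real (card {y' \<in> B. f x y' \<ge> f x y + b}) < \<eta> * n"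
      using regular_opp_row[OF regB] unfolding n_def by blast
    moreover have "card {y' \<in> Q. f x y' \<ge> t + b} \<le> card {y' \<in> B. f x y' \<ge> f x y + b}"
      using y QB fin by (intro card_mono) auto
    ultimately show ?thesis by linarith
  qed
  have col: "real (card {x \<in> P. f x y' \<le> t + b}) \<le> \<eta> * m" if "y' \<in> Q" for y'
  proof -
    from that obtain x' where x': "x' \<in> A" "y' \<in> B" "(x', y') \<notin> top" "f x' y' \<ge> t + a + b"
      unfolding Q_def H_def g_def by auto
    then have "(y', x') \<notin> top'" unfolding top_def by force
    \<comment> \<open>Writing the value as \<open>f x' y' - a + a\<close> matches the form of
      \<open>regular_set\<close> with threshold \<open>f x' y' - a\<close>, which is at least
      \<open>t + b\<close>.\<close>
    then have "\<eta> * m \<le> real (card {x \<in> A. f x y' \<ge> f x' y' - a + a})"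
      using x' unfolding top'_def by auto
    then have "real (card {x \<in> A. f x y' \<le> f x' y' - a}) < \<eta> * m"
      using regA x'(2) unfolding regular_set_def m_def by (meson not_less)
    moreover have "card {x \<in> P. f x y' \<le> t + b} \<le> card {x \<in> A. f x y' \<le> f x' y' - a}"
      using x' PA fin by (intro card_mono) auto
    ultimately show ?thesis by linarith
  qed
  define S1 where "S1 = Sigma P (\<lambda>x. {y' \<in> Q. f x y' \<ge> t + b})"
  define S2 where "S2 = Sigma Q (\<lambda>y'. {x \<in> P. f x y' \<le> t + b})"
  have "real (card S1) = (\<Sum>x\<in>P. real (card {y' \<in> Q. f x y' \<ge> t + b}))"
    unfolding S1_def using finP finQ by (simp add: card_SigmaI)
  also have "\<dots> \<le> (\<Sum>x\<in>P. \<eta> * n)" by (intro sum_mono row)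
  finally have S1: "real (card S1) \<le> real (card P) * (\<eta> * n)" by simp
  have "real (card S2) = (\<Sum>y'\<in>Q. real (card {x \<in> P. f x y' \<le> t + b}))"
    unfolding S2_def using finP finQ by (simp add: card_SigmaI)
  also have "\<dots> \<le> (\<Sum>y'\<in>Q. \<eta> * m)" by (intro sum_mono col)
  finally have S2: "real (card S2) \<le> real (card Q) * (\<eta> * m)" by simp
  have finS: "finite S1" "finite S2" unfolding S1_def S2_def using finP finQ by auto
  \<comment> \<open>Each corner value is at least or at most \<open>t + b\<close>, so the two kinds
    of jump cover the rectangle.\<close>
  have "P \<times> Q \<subseteq> S1 \<union> prod.swap ` S2" unfolding S1_def S2_def by force
  then have "card (P \<times> Q) \<le> card (S1 \<union> prod.swap ` S2)" using finS by (intro card_mono) auto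
  also have "\<dots> \<le> card S1 + card (prod.swap ` S2)" by (rule card_Un_le)
  also have "\<dots> \<le> card S1 + card S2" using card_image_le[OF finS(2)] by simp
  finally have "real (card P) * real (card Q) \<le> real (card P) * (\<eta> * n) + real (card Q) * (\<eta> * m)"
    using S1 S2 by (simp add: card_cartesian_product flip: of_nat_mult)
  \<comment> \<open>As \<open>P\<close> has more than \<open>2 * \<eta> * m\<close> rows, the column
    term is at most half of the rectangle and can be absorbed, which bounds
    \<open>Q\<close>.\<close>
  moreover have "real (card Q) * (2 * \<eta> * m) \<le> real (card Q) * real (card P)"
    using Pbig by (intro mult_left_mono) auto
  ultimately have "real (card P) * real (card Q) \<le> real (card P) * (2 * \<eta> * n)"
    by (simp add: algebra_simps)
  moreover have "real (card P) > 0" using Pbig \<open>0 < \<eta>\<close> m by (smt (verit) mult_nonneg_nonneg)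
  ultimately have Qsmall: "real (card Q) \<le> 2 * \<eta> * n" by simp
  have "card H \<le> card (A \<times> Q)"
    unfolding Q_def H_def using fin by (intro card_mono) (force intro!: finite_cartesian_product)+
  then have "real (card H) \<le> m * real (card Q)"
    unfolding m_def by (simp add: card_cartesian_product flip: of_nat_mult)
  also have "\<dots> \<le> m * (2 * \<eta> * n)" using Qsmall m by (intro mult_left_mono) auto
  finally have Hc: "real (card H) \<le> 2 * \<eta> * m * n" by (simp add: mult_ac)
  \<comment> \<open>The half-open window makes differences strictly less than \<open>a + b\<close>.
    The pairs outside it lie in \<open>bot\<close>, \<open>top\<close>, \<open>L\<close> or
    \<open>H\<close>, which cost \<eta>, \<eta>, 2\<eta> and 2\<eta>, together 6\<eta>.\<close>
  define E where "E = {p \<in> A \<times> B. t \<le> g p \<and> g p < t + a + b}"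
  define L where "L = {p \<in> N. g p < t}"
  have finb: "finite bot" "finite top" using bots tops finAB finite_subset by auto
  have finLH: "finite L" "finite H" unfolding L_def H_def using finN finAB by auto
  have finE: "finite E" unfolding E_def using finAB by simp
  have "A \<times> B \<subseteq> E \<union> (bot \<union> L) \<union> (top \<union> H)" unfolding E_def L_def N_def H_def by auto
  then have "card (A \<times> B) \<le> card (E \<union> (bot \<union> L) \<union> (top \<union> H))"
    using finE finb finLH by (intro card_mono) auto
  also have "\<dots> \<le> card E + (card bot + card L) + (card top + card H)"
    by (meson add_mono card_Un_le order_refl order_trans)
  finally have "m * n \<le> real (card E) + (real (card bot) + real (card L)) + (real (card top) + real (card H))"
    using cAB by linarith
  then have "m * n - 6 * \<eta> * (m * n) < real (card E)"
    using botc topc t(1) Hc unfolding L_def[symmetric] by (simp add: algebra_simps)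
  moreover have "6 * \<eta> * (m * n) \<le> \<epsilon> * (m * n)" using assms(9) m n by (intro mult_right_mono) auto
  ultimately have "(1 - \<epsilon>) * m * n < real (card E)" by (simp add: algebra_simps)
  moreover have "E \<subseteq> A \<times> B" unfolding E_def by auto
  moreover have "\<forall>(x, y)\<in>E. \<forall>(x', y')\<in>E. \<bar>f x y - f x' y'\<bar> < a + b"
    unfolding E_def g_def by (auto simp: abs_less_iff)
  ultimately show ?thesis unfolding almost_constant_def m_def n_def by blast
qed

section \<open>Combining the partitions of both sides\<close>

lemma regular_set_subset:
  "regular_set f Y \<eta> \<Delta> A \<Longrightarrow> B \<subseteq> Y \<Longrightarrow> regular_set f B \<eta> \<Delta> A"
  unfolding regular_set_def by blast

theorem theorem1p9:
  fixes k k' :: nat and \<delta> \<delta>' \<epsilon> :: real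
    and X :: "'a set" and Y :: "'b set" and f :: "'a \<Rightarrow> 'b \<Rightarrow> real"
  assumes "k \<ge> 1" and "k' \<ge> 1"
    and "\<delta> > 0" and "\<delta>' > 0" and "\<epsilon> > 0" and "\<epsilon> < 1"
    and "finite X" and "X \<noteq> {}" and "finite Y" and "Y \<noteq> {}"
    and "\<forall>x\<in>X. \<forall>y\<in>Y. f x y \<in> {0..1}"
    and "omits_ladders X Y f k \<delta>"
    and "omits_ladders Y X (opp f) k' \<delta>'"
  shows "\<exists>(s\<^sub>1::nat) (s\<^sub>2::nat) P Q.
    real s\<^sub>1 \<le> (9 / \<epsilon>) ^ (4 ^ k') \<and> real s\<^sub>2 \<le> (9 / \<epsilon>) ^ (4 ^ k) \<and>
    partition_on X P \<and> card P = s\<^sub>1 \<and> P \<subseteq> definable_sets X Y f \<and>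
    partition_on Y Q \<and> card Q = s\<^sub>2 \<and> Q \<subseteq> definable_sets Y X (opp f) \<and>
    (\<forall>A\<in>P. \<forall>B\<in>Q. almost_constant f \<epsilon> (2 * (\<delta> + \<delta>')) A B)"
proof -
  \<comment> \<open>With parameter \<epsilon>/9 the pieces are regular with constant 3/2 *
    \<epsilon>/9 = \<epsilon>/6, and six times this is \<epsilon>, as the pair lemma
    demands.\<close>
  have \<eta>: "0 < \<epsilon> / 9" "\<epsilon> / 9 \<le> 1 / 2" using assms(5,6) by auto
  have opp_opp: "opp (opp f) = f" by (simp add: opp_def)
  have rng: "\<forall>y\<in>Y. \<forall>x\<in>X. opp f y x \<in> {0..1}" using assms(11) by (simp add: opp_def)
  have om: "omits_ladders X Y (opp (opp f)) k \<delta>" using assms(12) opp_opp by simp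
  \<comment> \<open>The partition of \<open>Y\<close> is that of the first variable of
    \<open>opp f\<close>, whose opposite is \<open>f\<close>; hence \<open>k\<close> bounds
    \<open>Q\<close> and \<open>k'\<close> bounds \<open>P\<close>.\<close>
  obtain Q where Q: "partition_on Y Q" "Q \<subseteq> definable_sets Y X (opp f)"
    "real (card Q) \<le> (1 / (\<epsilon> / 9)) ^ (4 ^ k)"
    "\<And>B. B \<in> Q \<Longrightarrow> regular_set (opp f) X (3 / 2 * (\<epsilon> / 9)) (2 * \<delta>) B"
    using regular_partition[OF assms(9,10,8) rng om assms(1,3) \<eta>] by blast
  obtain P where P: "partition_on X P" "P \<subseteq> definable_sets X Y f"
    "real (card P) \<le> (1 / (\<epsilon> / 9)) ^ (4 ^ k')"
    "\<And>A. A \<in> P \<Longrightarrow> regular_set f Y (3 / 2 * (\<epsilon> / 9)) (2 * \<delta>') A"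
    using regular_partition[OF assms(7,8,10,11,13,2,4) \<eta>] by blast
  have "almost_constant f \<epsilon> (2 * (\<delta> + \<delta>')) A B" if "A \<in> P" "B \<in> Q" for A B
  proof -
    have sub: "A \<subseteq> X" "B \<subseteq> Y" "A \<noteq> {}" "B \<noteq> {}"
      using that P(1) Q(1) unfolding partition_on_def by auto
    have "almost_constant f \<epsilon> (2 * \<delta>' + 2 * \<delta>) A B"
    proof (rule regular_pair_almost_constant)
      show "regular_set f B (3 / 2 * (\<epsilon> / 9)) (2 * \<delta>') A"
        using P(4)[OF that(1)] sub(2) by (rule regular_set_subset)
      show "regular_set (opp f) A (3 / 2 * (\<epsilon> / 9)) (2 * \<delta>) B"
        using Q(4)[OF that(2)] sub(1) by (rule regular_set_subset)
    qed (use sub assms(5,6) finite_subset[OF sub(1) assms(7)] finite_subset[OF sub(2) assms(9)] in auto)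
    then show ?thesis by (simp add: algebra_simps)
  qed
  with P(1-3) Q(1-3) show ?thesis
    by (intro exI[of _ "card P"] exI[of _ "card Q"] exI[of _ P] exI[of _ Q]) simp
qed

end
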